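(* Every isonemal fabric of species $34$, $36$ or $39$ can be doubled and remain isonemal, the doubled fabric being of species $33$, $35$ or $38$, respectively. Isonemal fabrics of species $33$, $35$, $37$ and $38$ cannot be doubled and remain isonemal.
   Context: The plane $E$ is tessellated by unit squares called cells, with horizontal and vertical sides. The strands are the vertical columns of cells (warps) and the horizontal rows of cells (wefts). A prefabric assigns to each cell which of the two strands crossing there is uppermost; its design colours a cell dark if the warp is uppermost and pale if the weft is. A fabric is a prefabric that hangs together: its strands cannot be partitioned into two non-empty sets such that every strand of the first passes over every strand of the second wherever they cross. A symmetry is a pair $(g,\epsilon)$, where $g$ is an isometry of $E$ mapping the tessellation by cells to itself and $\epsilon\in\{e,\tau\}$: if $\epsilon=e$, $g$ carries the uppermost strand at each cell $c$ to the uppermost strand at $g(c)$; if $\epsilon=\tau$, $g$ carries the uppermost strand at $c$ to the lowermost strand at $g(c)$. The symmetries form the group $G$; $G_1$ is the planar group of all $g$ occurring in $G$. The prefabric is isonemal if $G$ is transitive on the strands. A rotation $g\in G_1$ is called preserving if $(g,e)\in G$ and reversing if $(g,\tau)\in G$. Doubling replaces each strand by a pair of adjacent strands with the same behaviour: indexing cells by $\mathbb{Z}^2$, the design $D(i,j)$ becomes $D'(i,j)=D(\lfloor i/2\rfloor,\lfloor j/2\rfloor)$. For a group $G_1$ of type $p4$, a lattice unit is a square whose side vectors generate the translation subgroup and whose corners are centres of quarter-turns (its centre is then also one, and the mid-points of its sides are centres of half-turns). Levels: a level-$1$ unit is a square on the hypotenuse of a right triangle with horizontal and vertical sides positive integers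 of opposite parity, with corners all at cell corners or all at cell centres. A unit of level $n+1$ is a square escribing a unit of level $n$, i.e. having the corners of the level-$n$ unit as the mid-points of its sides. Species (all with $G_1$ of type $p4$, for the full symmetry group): $36_1$: level-$1$ lattice unit, all quarter-turns reversing. $39$: level-$1$ lattice unit, quarter-turns at cell centres reversing and those at cell corners preserving. $34$: level-$2$ lattice unit with centre and corners at cell corners, all quarter-turns preserving. $36_2$: level-$2$ lattice unit with centre and corners at cell corners, all quarter-turns reversing. $36_s$: level-$2$ lattice unit with centre and corners at cell centres, all quarter-turns reversing. $33_3$ (resp. $33_4$): level-$3$ (resp. level-$4$) lattice unit with centre and corners at cell corners, all quarter-turns preserving. $35_3$ (resp. $35_4$): level-$3$ (resp. level-$4$) lattice unit with centre and corners at cell corners, all quarter-turns reversing. $38$ (resp. $37$): level-$3$ (resp. level-$4$) lattice unit with centre and corners at cell corners, the quarter-turns at the centre being of one kind (preserving or reversing) and those at the corners of the other kind. Species $33$ consists of $33_3$ and $33_4$; species $35$ of $35_3$ and $35_4$; species $36$ of $36_1$, $36_2$ and $36_s$. *)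

theory Defs
  imports Complex_Main
begin

(* The plane E is the complex plane; the cell with index (i, j) is the closed unit square with
   lower left corner i + j * \<i>.  A prefabric is represented by its design: D (i, j) holds
   iff the cell is dark, that is, the warp in column i is uppermost there. *)

type_synonym cell_index = "int \<times> int"
type_synonym design = "cell_index \<Rightarrow> bool"

datatype strand = Warp int | Weft int

fun cell :: "cell_index \<Rightarrow> complex set" where
  "cell (i, j) = {z. Re z \<in> {of_int i..of_int i + 1} \<and> Im z \<in> {of_int j..of_int j + 1}}"

fun region :: "strand \<Rightarrow> complex set" where
  "region (Warp i) = {z. Re z \<in> {of_int i..of_int i + 1}}"
| "region (Weft j) = {z. Im z \<in> {of_int j..of_int j + 1}}"

definition cell_corners :: "complex set" where
  "cell_corners = {z. Re z \<in> \<int> \<and> Im z \<in> \<int>}"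

definition cell_centres :: "complex set" where
  "cell_centres = {z. Re z - 1/2 \<in> \<int> \<and> Im z - 1/2 \<in> \<int>}"

fun strands_at :: "cell_index \<Rightarrow> strand set" where
  "strands_at (i, j) = {Warp i, Weft j}"

fun uppermost :: "design \<Rightarrow> cell_index \<Rightarrow> strand" where
  "uppermost D (i, j) = (if D (i, j) then Warp i else Weft j)"

fun lowermost :: "design \<Rightarrow> cell_index \<Rightarrow> strand" where
  "lowermost D (i, j) = (if D (i, j) then Weft j else Warp i)"

(* Vacuously true for parallel strands, which never cross. *)
definition passes_over :: "design \<Rightarrow> strand \<Rightarrow> strand \<Rightarrow> bool" where
  "passes_over D s t \<longleftrightarrow> (\<forall>c. strands_at c = {s, t} \<longrightarrow> uppermost D c = s)"

definition fabric :: "design \<Rightarrow> bool" where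
  "fabric D \<longleftrightarrow> \<not> (\<exists>A B. A \<noteq> {} \<and> B \<noteq> {} \<and> A \<inter> B = {} \<and> A \<union> B = UNIV \<and>
     (\<forall>s\<in>A. \<forall>t\<in>B. passes_over D s t))"

definition isometry :: "(complex \<Rightarrow> complex) \<Rightarrow> bool" where
  "isometry g \<longleftrightarrow> (\<forall>x y. dist (g x) (g y) = dist x y)"

definition maps_tessellation :: "(complex \<Rightarrow> complex) \<Rightarrow> bool" where
  "maps_tessellation g \<longleftrightarrow> (\<lambda>C. g ` C) ` range cell = range cell"

(* The second component of a symmetry: Identity is e, Reversal is \<tau>. *)
datatype side_effect = Identity | Reversal

fun target :: "design \<Rightarrow> side_effect \<Rightarrow> cell_index \<Rightarrow> strand" where
  "target D Identity c = uppermost D c"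
| "target D Reversal c = lowermost D c"

definition symmetry_group :: "design \<Rightarrow> ((complex \<Rightarrow> complex) \<times> side_effect) set" where
  "symmetry_group D = {(g, \<epsilon>). isometry g \<and> maps_tessellation g \<and>
     (\<forall>c c'. g ` cell c = cell c' \<longrightarrow> g ` region (uppermost D c) = region (target D \<epsilon> c'))}"

definition planar_group :: "design \<Rightarrow> (complex \<Rightarrow> complex) set" where
  "planar_group D = fst ` symmetry_group D"

definition isonemal :: "design \<Rightarrow> bool" where
  "isonemal D \<longleftrightarrow>
     (\<forall>s t. \<exists>g \<epsilon>. (g, \<epsilon>) \<in> symmetry_group D \<and> g ` region s = region t)"

definition preserving :: "design \<Rightarrow> (complex \<Rightarrow> complex) \<Rightarrow> bool" where
  "preserving D g \<longleftrightarrow> (g, Identity) \<in> symmetry_group D"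

definition reversing :: "design \<Rightarrow> (complex \<Rightarrow> complex) \<Rightarrow> bool" where
  "reversing D g \<longleftrightarrow> (g, Reversal) \<in> symmetry_group D"

fun doubled :: "design \<Rightarrow> design" where
  "doubled D (i, j) = D (i div 2, j div 2)"

definition translation_vectors :: "(complex \<Rightarrow> complex) set \<Rightarrow> complex set" where
  "translation_vectors \<Gamma> = {b. (\<lambda>z. z + b) \<in> \<Gamma>}"

definition lattice :: "complex \<Rightarrow> complex \<Rightarrow> complex set" where
  "lattice v w = {of_int m * v + of_int n * w | m n. True}"

(* A plane group is of type p4 iff its translations form a lattice of rank 2 and its point group
   (the group of linear parts) is the group of rotations generated by a quarter-turn; in
   particular it contains neither reflections nor glide-reflections. *)
definition type_p4 :: "(complex \<Rightarrow> complex) set \<Rightarrow> bool" where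
  "type_p4 \<Gamma> \<longleftrightarrow>
     (\<exists>v w. v \<noteq> w \<and> independent {v, w} \<and> translation_vectors \<Gamma> = lattice v w) \<and>
     (\<forall>g\<in>\<Gamma>. \<exists>u b. g = (\<lambda>z. u * z + b)) \<and>
     {u. \<exists>b. (\<lambda>z. u * z + b) \<in> \<Gamma>} = {1, \<i>, - 1, - \<i>}"

(* Quarter-turns in either sense. *)
definition quarter_turns_about :: "(complex \<Rightarrow> complex) set \<Rightarrow> complex \<Rightarrow> (complex \<Rightarrow> complex) set"
  where "quarter_turns_about \<Gamma> q = \<Gamma> \<inter> {\<lambda>z. q + \<i> * (z - q), \<lambda>z. q - \<i> * (z - q)}"

(* A square is given by a corner p and the vector v of the side leaving p in the
   counterclockwise sense. *)
definition sq_corners :: "complex \<Rightarrow> complex \<Rightarrow> complex set" where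
  "sq_corners p v = {p, p + v, p + v + \<i> * v, p + \<i> * v}"

definition sq_midpoints :: "complex \<Rightarrow> complex \<Rightarrow> complex set" where
  "sq_midpoints p v = {p + v / 2, p + v + \<i> * v / 2, p + v / 2 + \<i> * v, p + \<i> * v / 2}"

definition sq_centre :: "complex \<Rightarrow> complex \<Rightarrow> complex" where
  "sq_centre p v = p + (v + \<i> * v) / 2"

definition lattice_unit :: "(complex \<Rightarrow> complex) set \<Rightarrow> complex \<Rightarrow> complex \<Rightarrow> bool" where
  "lattice_unit \<Gamma> p v \<longleftrightarrow> v \<noteq> 0 \<and> translation_vectors \<Gamma> = lattice v (\<i> * v) \<and>
     (\<forall>q\<in>sq_corners p v. quarter_turns_about \<Gamma> q \<noteq> {})"

inductive unit_of_level :: "nat \<Rightarrow> complex \<Rightarrow> complex \<Rightarrow> bool" where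
  base: "unit_of_level 1 p v"
    if "0 < a" and "0 < b" and "even a \<noteq> even b"
      and "\<bar>Re v\<bar> = of_nat a" and "\<bar>Im v\<bar> = of_nat b"
      and "sq_corners p v \<subseteq> cell_corners \<or> sq_corners p v \<subseteq> cell_centres"
| escribe: "unit_of_level (Suc n) p v"
    if "unit_of_level n q w" and "sq_midpoints p v = sq_corners q w"

definition p4_unit :: "design \<Rightarrow> nat \<Rightarrow> complex \<Rightarrow> complex \<Rightarrow> bool" where
  "p4_unit D n p v \<longleftrightarrow> type_p4 (planar_group D) \<and> lattice_unit (planar_group D) p v \<and>
     unit_of_level n p v"

definition centre_and_corners_in :: "complex set \<Rightarrow> complex \<Rightarrow> complex \<Rightarrow> bool" where
  "centre_and_corners_in S p v \<longleftrightarrow> sq_centre p v \<in> S \<and> sq_corners p v \<subseteq> S"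

definition turns_preserving :: "design \<Rightarrow> complex set \<Rightarrow> bool" where
  "turns_preserving D S \<longleftrightarrow> (\<forall>q\<in>S. \<forall>g\<in>quarter_turns_about (planar_group D) q. preserving D g)"

definition turns_reversing :: "design \<Rightarrow> complex set \<Rightarrow> bool" where
  "turns_reversing D S \<longleftrightarrow> (\<forall>q\<in>S. \<forall>g\<in>quarter_turns_about (planar_group D) q. reversing D g)"

definition species_36_1 :: "design \<Rightarrow> bool" where
  "species_36_1 D \<longleftrightarrow> (\<exists>p v. p4_unit D 1 p v) \<and> turns_reversing D UNIV"

definition species_39 :: "design \<Rightarrow> bool" where
  "species_39 D \<longleftrightarrow> (\<exists>p v. p4_unit D 1 p v) \<and>
     turns_reversing D cell_centres \<and> turns_preserving D cell_corners"

definition species_34 :: "design \<Rightarrow> bool" where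
  "species_34 D \<longleftrightarrow> (\<exists>p v. p4_unit D 2 p v \<and> centre_and_corners_in cell_corners p v) \<and>
     turns_preserving D UNIV"

definition species_36_2 :: "design \<Rightarrow> bool" where
  "species_36_2 D \<longleftrightarrow> (\<exists>p v. p4_unit D 2 p v \<and> centre_and_corners_in cell_corners p v) \<and>
     turns_reversing D UNIV"

definition species_36_s :: "design \<Rightarrow> bool" where
  "species_36_s D \<longleftrightarrow> (\<exists>p v. p4_unit D 2 p v \<and> centre_and_corners_in cell_centres p v) \<and>
     turns_reversing D UNIV"

definition species_33_level :: "nat \<Rightarrow> design \<Rightarrow> bool" where
  "species_33_level n D \<longleftrightarrow> (\<exists>p v. p4_unit D n p v \<and> centre_and_corners_in cell_corners p v) \<and>
     turns_preserving D UNIV"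

definition species_35_level :: "nat \<Rightarrow> design \<Rightarrow> bool" where
  "species_35_level n D \<longleftrightarrow> (\<exists>p v. p4_unit D n p v \<and> centre_and_corners_in cell_corners p v) \<and>
     turns_reversing D UNIV"

definition species_mixed_level :: "nat \<Rightarrow> design \<Rightarrow> bool" where
  "species_mixed_level n D \<longleftrightarrow> (\<exists>p v. p4_unit D n p v \<and> centre_and_corners_in cell_corners p v \<and>
     (turns_preserving D {sq_centre p v} \<and> turns_reversing D (sq_corners p v) \<or>
      turns_reversing D {sq_centre p v} \<and> turns_preserving D (sq_corners p v)))"

definition species_33 :: "design \<Rightarrow> bool" where
  "species_33 D \<longleftrightarrow> species_33_level 3 D \<or> species_33_level 4 D"

definition species_35 :: "design \<Rightarrow> bool" where
  "species_35 D \<longleftrightarrow> species_35_level 3 D \<or> species_35_level 4 D"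

definition species_36 :: "design \<Rightarrow> bool" where
  "species_36 D \<longleftrightarrow> species_36_1 D \<or> species_36_2 D \<or> species_36_s D"

definition species_37 :: "design \<Rightarrow> bool" where
  "species_37 D \<longleftrightarrow> species_mixed_level 4 D"

definition species_38 :: "design \<Rightarrow> bool" where
  "species_38 D \<longleftrightarrow> species_mixed_level 3 D"

end

theory Submission
  imports Defs
begin

text \<open>
  A strand with the same colour along its whole length would lie above or below everything it
  crosses, so in a fabric every row and every column of the design changes colour somewhere. In the
  doubled design the lines between twin strands separate cells of equal colour, and each row and
  each column changes colour at some of the other lines. A symmetry of the doubled fabric therefore
  maps lines between twins to such lines, which means that it is a symmetry of the original fabric
  magnified by the factor 2 (lemma \<open>symmetry_group_doubled\<close>). Thus doubling magnifies
  the group and its lattice unit, and leaves every symmetry with its side effect.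

  Each strand becomes a pair of adjacent strands. If the original is isonemal, the doubled fabric is
  isonemal exactly when some symmetry of the original exchanges the two halves of a strand. In a
  group of type \<open>p4\<close> only a half-turn can do that, and its centre must lie on the centre line of
  the strand. A half-turn is \<open>z \<mapsto> - z + b\<close> with \<open>b\<close> a Gaussian integer, and the condition is
  that one coordinate of \<open>b\<close> is odd (lemmas \<open>isonemal_doubledI\<close> and \<open>isonemal_doubledD\<close>). For a
  lattice unit with corner \<open>p\<close> and side \<open>v\<close> the possible values of \<open>b\<close> are the elements of
  \<open>2 * p\<close> plus the lattice.

  Escribing multiplies the side by \<open>1 - \<i>\<close> up to a unit of the Gaussian integers, so that a unit of
  level \<open>n\<close> has a side \<open>(1 - \<i>) ^ (n - 1) * w\<close> where the coordinates of \<open>w\<close> are non-zero integers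
  of opposite parity. For \<open>n \<ge> 3\<close> the side is divisible by 2, so all \<open>b\<close> are even if \<open>p\<close> is a cell
  corner, and doubling destroys isonemality. At the levels 1 and 2 the side has an odd coordinate,
  so \<open>b = 2 * p + v\<close> has one if \<open>p\<close> is a cell corner; and if \<open>p\<close> is a cell centre, then \<open>b = 2 * p\<close>
  has. Finally \<open>2 = (1 - \<i>)\<^sup>2 * \<i>\<close>, so magnification by 2 raises the level of a unit by two: the levels
  1 and 2 become 3 and 4.
\<close>

section \<open>Isometries of the tessellation in coordinates\<close>

text \<open>A pair \<open>(r, a)\<close> stands for the reflection \<open>x \<mapsto> a - x\<close> of a coordinate axis if \<open>r\<close> holds,
  and for the translation \<open>x \<mapsto> x + a\<close> otherwise.\<close>

fun axis_map :: "bool \<times> int \<Rightarrow> real \<Rightarrow> real" where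
  "axis_map (r, a) x = (if r then of_int a - x else x + of_int a)"

text \<open>The effect on the interval from \<open>i\<close> to \<open>i + 1\<close>, named by its lower end: a reflection
  makes the upper end the lower one, whence the shift by one.\<close>

fun index_map :: "bool \<times> int \<Rightarrow> int \<Rightarrow> int" where
  "index_map (r, a) i = (if r then a - 1 - i else i + a)"

text \<open>The flag \<open>sw\<close> tells whether the two axes, and with them warps and wefts, are exchanged.\<close>

definition grid_map :: "bool \<Rightarrow> bool \<times> int \<Rightarrow> bool \<times> int \<Rightarrow> complex \<Rightarrow> complex" where
  "grid_map sw A B z =
     (if sw then Complex (axis_map A (Im z)) (axis_map B (Re z))
      else Complex (axis_map A (Re z)) (axis_map B (Im z)))"

fun cell_map :: "bool \<Rightarrow> bool \<times> int \<Rightarrow> bool \<times> int \<Rightarrow> cell_index \<Rightarrow> cell_index" where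
  "cell_map sw A B (i, j) =
     (if sw then (index_map A j, index_map B i) else (index_map A i, index_map B j))"

fun strand_map :: "bool \<Rightarrow> bool \<times> int \<Rightarrow> bool \<times> int \<Rightarrow> strand \<Rightarrow> strand" where
  "strand_map sw A B (Warp i) = (if sw then Weft (index_map B i) else Warp (index_map A i))"
| "strand_map sw A B (Weft j) = (if sw then Warp (index_map A j) else Weft (index_map B j))"

fun axis_inverse :: "bool \<times> int \<Rightarrow> bool \<times> int" where
  "axis_inverse (r, a) = (r, if r then a else - a)"

lemma axis_map_inverse [simp]:
  "axis_map A (axis_map (axis_inverse A) x) = x" "axis_map (axis_inverse A) (axis_map A x) = x"
  by (cases A; simp)+

lemma index_map_inverse [simp]:
  "index_map A (index_map (axis_inverse A) i) = i" "index_map (axis_inverse A) (index_map A i) = i"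
  by (cases A; simp)+

lemma axis_map_interval_iff:
  "axis_map A x \<in> {of_int (index_map A i)..of_int (index_map A i) + 1} \<longleftrightarrow> x \<in> {of_int i..of_int i + 1}"
  by (cases A) auto

lemma grid_map_inverse:
  obtains h where "\<And>z. grid_map sw A B (h z) = z" "\<And>z. h (grid_map sw A B z) = z"
proof
  let ?h = "if sw then grid_map sw (axis_inverse B) (axis_inverse A)
    else grid_map sw (axis_inverse A) (axis_inverse B)"
  show "grid_map sw A B (?h z) = z" "?h (grid_map sw A B z) = z" for z
    by (auto simp: grid_map_def)
qed

lemma grid_map_image_eqI:
  assumes "\<And>z. grid_map sw A B z \<in> T \<longleftrightarrow> z \<in> S"
  shows "grid_map sw A B ` S = T"
  by (metis (no_types, lifting) assms grid_map_inverse image_eqI image_subsetI subsetI subset_antisym)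

lemma grid_map_cell: "grid_map sw A B ` cell c = cell (cell_map sw A B c)"
  by (cases c, rule grid_map_image_eqI)
    (auto simp: grid_map_def axis_map_interval_iff simp del: atLeastAtMost_iff)

lemma grid_map_region: "grid_map sw A B ` region s = region (strand_map sw A B s)"
  by (cases s; rule grid_map_image_eqI)
    (auto simp: grid_map_def axis_map_interval_iff simp del: atLeastAtMost_iff)

lemma cell_inj: assumes "cell c = cell c'" shows "c = c'"
proof -
  obtain i j k l where c: "c = (i, j)" "c' = (k, l)" by fastforce
  have "Complex x y \<in> cell c \<longleftrightarrow> Complex x y \<in> cell c'" for x y using assms by simp
  then have *: "x \<in> {of_int i..of_int i + 1} \<and> y \<in> {of_int j..of_int j + 1} \<longleftrightarrow>
     x \<in> {of_int k..of_int k + 1} \<and> y \<in> {of_int l..of_int l + 1}" for x y :: real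
    by (simp add: c)
  show ?thesis
    using *[of "of_int i" "of_int j"] *[of "of_int k" "of_int l"] by (simp add: c)
qed

lemma region_inj: assumes "region s = region t" shows "s = t"
proof -
  have *: "Complex x y \<in> region s \<longleftrightarrow> Complex x y \<in> region t" for x y using assms by simp
  show ?thesis
  proof (cases s; cases t)
    fix i k assume "s = Warp i" "t = Warp k"
    then show ?thesis using *[of "of_int i" 0] *[of "of_int k" 0] by simp
  next
    fix i k assume "s = Warp i" "t = Weft k"
    then show ?thesis using *[of "of_int i" "of_int k"] *[of "of_int i" "of_int k + 2"] by simp
  next
    fix i k assume "s = Weft i" "t = Warp k"
    then show ?thesis using *[of "of_int k" "of_int i"] *[of "of_int k" "of_int i + 2"] by simp
  next
    fix i k assume "s = Weft i" "t = Weft k"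
    then show ?thesis using *[of 0 "of_int i"] *[of 0 "of_int k"] by simp
  qed
qed

lemma cell_eq_iff: "cell c = cell c' \<longleftrightarrow> c = c'"
  using cell_inj by blast

lemma region_eq_iff: "region s = region t \<longleftrightarrow> s = t"
  using region_inj by blast

lemma dist_complex: "dist z w = sqrt ((Re z - Re w)\<^sup>2 + (Im z - Im w)\<^sup>2)"
  by (simp add: dist_norm cmod_def)

lemma isometry_grid_map: "isometry (grid_map sw A B)"
  by (cases A; cases B) (auto simp: isometry_def grid_map_def dist_complex power2_commute add.commute)

lemma maps_tessellation_grid_map: "maps_tessellation (grid_map sw A B)"
proof -
  have "cell c \<in> (\<lambda>C. grid_map sw A B ` C) ` range cell" for c
  proof -
    obtain i j where c: "c = (i, j)" by fastforce
    define c' where "c' = (if sw then (index_map (axis_inverse B) j, index_map (axis_inverse A) i)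
      else (index_map (axis_inverse A) i, index_map (axis_inverse B) j))"
    have "cell_map sw A B c' = c" by (auto simp: c'_def c)
    then have "cell c = grid_map sw A B ` cell c'" by (simp add: grid_map_cell)
    then show ?thesis by blast
  qed
  then show ?thesis unfolding maps_tessellation_def
    by (auto simp: grid_map_cell simp del: cell.simps)
qed

text \<open>The squared distance 2 between points of a unit square is reached only by opposite corners,
  which is how an isometry that maps cells to cells is seen to map cell corners to cell corners.\<close>

lemma diagonal_of_interval_square:
  fixes x y x' y' m n :: real
  assumes "x \<in> {m..m+1}" "x' \<in> {m..m+1}" "y \<in> {n..n+1}" "y' \<in> {n..n+1}"
    and "(x - x')\<^sup>2 + (y - y')\<^sup>2 = 2"
  shows "x \<in> {m, m+1} \<and> y \<in> {n, n+1}"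
proof -
  have "\<bar>x - x'\<bar> \<le> 1" "\<bar>y - y'\<bar> \<le> 1" using assms by auto
  then have "(x - x')\<^sup>2 \<le> 1" "(y - y')\<^sup>2 \<le> 1" by (simp_all add: abs_square_le_1)
  then have "(x - x')\<^sup>2 = 1" "(y - y')\<^sup>2 = 1" using assms(5) by linarith+
  then have "\<bar>x - x'\<bar> = 1" "\<bar>y - y'\<bar> = 1" by (simp_all add: abs_square_eq_1)
  then show ?thesis using assms by auto
qed

text \<open>An isometry is determined by the images of \<open>0\<close>, \<open>1\<close> and \<open>\<i>\<close>. These are corners of one cell,
  so that the images \<open>u\<close> and \<open>w\<close> of the two coordinate directions are orthogonal vectors parallel to
  the axes.\<close>

lemma tessellation_isometry_is_grid_map:
  assumes iso: "isometry g" and "maps_tessellation g"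
  obtains sw A B where "g = grid_map sw A B"
proof -
  have "g ` cell (0, 0) \<in> range cell"
    using assms(2) unfolding maps_tessellation_def by blast
  then obtain m n where mn: "g ` cell (0, 0) = cell (m, n)" by fastforce
  have sq: "(Re (g z) - Re (g w))\<^sup>2 + (Im (g z) - Im (g w))\<^sup>2 =
      (Re z - Re w)\<^sup>2 + (Im z - Im w)\<^sup>2" for z w
    using iso by (simp add: isometry_def dist_complex)
  have corner: "Re (g (Complex x y)) \<in> {of_int m, of_int m + 1} \<and>
      Im (g (Complex x y)) \<in> {of_int n, of_int n + 1}"
    if "x \<in> {0, 1}" "y \<in> {0, 1}" for x y
  proof -
    have "Complex x y \<in> cell (0, 0)" "Complex (1 - x) (1 - y) \<in> cell (0, 0)" using that by auto
    then have "g (Complex x y) \<in> cell (m, n)" "g (Complex (1 - x) (1 - y)) \<in> cell (m, n)"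
      using mn by blast+
    moreover have "(x - (1 - x))\<^sup>2 + (y - (1 - y))\<^sup>2 = 2" using that by auto
    ultimately show ?thesis
      using sq[of "Complex x y" "Complex (1 - x) (1 - y)"]
      by (intro diagonal_of_interval_square[where x' = "Re (g (Complex (1 - x) (1 - y)))"
            and y' = "Im (g (Complex (1 - x) (1 - y)))"]) auto
  qed
  define P where "P = g 0"
  define u where "u = g 1 - P"
  define w where "w = g \<i> - P"
  have c0: "Re P \<in> {of_int m, of_int m + 1}" "Im P \<in> {of_int n, of_int n + 1}"
    using corner[of 0 0] by (simp_all add: P_def complex_eq_iff flip: zero_complex.code)
  have c1: "Re P + Re u \<in> {of_int m, of_int m + 1}" "Im P + Im u \<in> {of_int n, of_int n + 1}"
    using corner[of 1 0] by (simp_all add: u_def flip: one_complex.code)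
  have ci: "Re P + Re w \<in> {of_int m, of_int m + 1}" "Im P + Im w \<in> {of_int n, of_int n + 1}"
    using corner[of 0 1] by (simp_all add: w_def flip: imaginary_unit.code)
  have uu: "(Re u)\<^sup>2 + (Im u)\<^sup>2 = 1" using sq[of 1 0] by (simp add: u_def P_def)
  have ww: "(Re w)\<^sup>2 + (Im w)\<^sup>2 = 1" using sq[of \<i> 0] by (simp add: w_def P_def)
  \<comment> \<open>Polarisation: the distances between the three images determine the scalar products.\<close>
  have uw: "Re u * Re w + Im u * Im w = 0"
    using sq[of 1 \<i>] uu ww by (simp add: w_def u_def P_def power2_eq_square algebra_simps)
  have zz: "(Re (g z - P))\<^sup>2 + (Im (g z - P))\<^sup>2 = (Re z)\<^sup>2 + (Im z)\<^sup>2" for z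
    using sq[of z 0] by (simp add: P_def)
  have zu: "Re (g z - P) * Re u + Im (g z - P) * Im u = Re z" for z
    using sq[of z 1] zz[of z] uu by (simp add: u_def P_def power2_eq_square algebra_simps)
  have zw: "Re (g z - P) * Re w + Im (g z - P) * Im w = Im z" for z
    using sq[of z \<i>] zz[of z] ww by (simp add: w_def P_def power2_eq_square algebra_simps)
  obtain a b where ab: "Re P = of_int a" "Im P = of_int b"
    using c0 by (metis empty_iff insert_iff of_int_1 of_int_add)
  have axis: "Re u \<in> {-1, 0, 1} \<and> Im u \<in> {-1, 0, 1}" "Re w \<in> {-1, 0, 1} \<and> Im w \<in> {-1, 0, 1}"
    using c0 c1 ci by auto
  show ?thesis
  proof (cases "Im u = 0")
    case True
    then have u: "Re u = 1 \<or> Re u = -1" using uu by (simp add: power2_eq_1_iff)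
    then have w: "Re w = 0" using uw True by auto
    then have w': "Im w = 1 \<or> Im w = -1" using ww by (simp add: power2_eq_1_iff)
    have "g z = grid_map False (Re u = -1, a) (Im w = -1, b) z" for z
      using zu[of z] zw[of z] u w w' True ab by (auto simp: grid_map_def complex_eq_iff)
    then show ?thesis using that by blast
  next
    case False
    then have "\<bar>Im u\<bar> = 1" using axis by auto
    then have u: "Im u = 1 \<or> Im u = -1" by auto
    then have u0: "Re u = 0" using uu by auto
    then have w: "Im w = 0" using uw u by auto
    then have w': "Re w = 1 \<or> Re w = -1" using ww by (simp add: power2_eq_1_iff)
    have "g z = grid_map True (Re w = -1, a) (Im u = -1, b) z" for z
      using zu[of z] zw[of z] u u0 w w' ab by (auto simp: grid_map_def complex_eq_iff)
    then show ?thesis using that by blast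
  qed
qed

section \<open>The symmetry group in terms of the design\<close>

text \<open>A cell keeps its colour under a symmetry unless exactly one of two things happens: warps and
  wefts are exchanged, or the sides of the fabric are.\<close>

lemma grid_map_symmetry_iff:
  "(grid_map sw A B, \<epsilon>) \<in> symmetry_group D \<longleftrightarrow>
     (\<forall>c. D (cell_map sw A B c) = (D c \<noteq> (sw \<noteq> (\<epsilon> = Reversal))))"
proof -
  have "(grid_map sw A B, \<epsilon>) \<in> symmetry_group D \<longleftrightarrow>
      (\<forall>c. strand_map sw A B (uppermost D c) = target D \<epsilon> (cell_map sw A B c))"
    unfolding symmetry_group_def
    by (simp add: isometry_grid_map maps_tessellation_grid_map grid_map_cell grid_map_region
        cell_eq_iff region_eq_iff
        del: cell.simps region.simps cell_map.simps uppermost.simps split_paired_All)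
  also have "\<dots> \<longleftrightarrow> (\<forall>c. D (cell_map sw A B c) = (D c \<noteq> (sw \<noteq> (\<epsilon> = Reversal))))"
    by (cases \<epsilon>) auto
  finally show ?thesis .
qed

lemma symmetry_is_grid_map:
  assumes "(g, \<epsilon>) \<in> symmetry_group D"
  obtains sw A B where "g = grid_map sw A B"
proof -
  have "isometry g" "maps_tessellation g" using assms by (simp_all add: symmetry_group_def)
  then show ?thesis using tessellation_isometry_is_grid_map that by blast
qed

fun axis_comp :: "bool \<times> int \<Rightarrow> bool \<times> int \<Rightarrow> bool \<times> int" where
  "axis_comp (r, a) (r', a') = (r \<noteq> r', if r then a - a' else a + a')"

lemma axis_comp_maps [simp]:
  "axis_map (axis_comp A B) x = axis_map A (axis_map B x)"
  "index_map (axis_comp A B) i = index_map A (index_map B i)"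
  by (cases A; cases B; simp)+

lemma symmetry_comp:
  assumes g: "(g, \<epsilon>) \<in> symmetry_group D" and h: "(h, \<delta>) \<in> symmetry_group D"
  obtains \<gamma> where "(g \<circ> h, \<gamma>) \<in> symmetry_group D"
proof -
  obtain sw A B where gg: "g = grid_map sw A B" using symmetry_is_grid_map[OF g] .
  obtain sw' A' B' where hh: "h = grid_map sw' A' B'" using symmetry_is_grid_map[OF h] .
  let ?sw = "sw \<noteq> sw'"
  let ?A = "axis_comp A (if sw then B' else A')"
  let ?B = "axis_comp B (if sw then A' else B')"
  let ?\<gamma> = "if \<epsilon> = \<delta> then Identity else Reversal"
  have comp: "g \<circ> h = grid_map ?sw ?A ?B" by (auto simp: gg hh grid_map_def fun_eq_iff)
  have cells: "cell_map ?sw ?A ?B c = cell_map sw A B (cell_map sw' A' B' c)" for c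
    by (cases c) auto
  have "(g \<circ> h, ?\<gamma>) \<in> symmetry_group D"
    using g h unfolding comp unfolding gg hh grid_map_symmetry_iff cells
    by (cases \<epsilon>; cases \<delta>) auto
  then show ?thesis using that by blast
qed

lemma planar_group_comp:
  assumes "g \<in> planar_group D" "h \<in> planar_group D"
  shows "g \<circ> h \<in> planar_group D"
  using assms symmetry_comp unfolding planar_group_def by (metis (no_types, lifting) fst_conv image_iff prod.collapse)

section \<open>Symmetries of a doubled fabric\<close>

lemma fabric_iff:
  "fabric D \<longleftrightarrow> (\<forall>A. A \<noteq> {} \<longrightarrow> - A \<noteq> {} \<longrightarrow> (\<exists>s\<in>A. \<exists>t\<in>- A. \<not> passes_over D s t))"
proof -
  have "A \<inter> B = {} \<and> A \<union> B = UNIV \<longleftrightarrow> B = - A" for A B :: "strand set" by auto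
  then show ?thesis unfolding fabric_def by metis
qed

text \<open>A warp that is uppermost everywhere, or nowhere, can be lifted off the rest of the prefabric.\<close>

lemma fabric_column_nonconstant:
  assumes "fabric D" shows "\<exists>j. D (i, j) \<noteq> D (i, j + 1)"
proof (rule ccontr)
  assume "\<not> ?thesis"
  then have step: "D (i, j) = D (i, j + 1)" for j by blast
  have const: "D (i, j) = D (i, 0)" for j
  proof (induction j rule: int_induct[where k = 0])
    case (step2 k) then show ?case using step[of "k - 1"] by simp
  qed (use step in auto)
  let ?A = "if D (i, 0) then {Warp i} else - {Warp i}"
  have "passes_over D s t" if "s \<in> ?A" "t \<in> - ?A" for s t
    using that const by (auto simp: passes_over_def doubleton_eq_iff split: if_splits)
  moreover have "?A \<noteq> {}" "- ?A \<noteq> {}" by (auto intro: exI[of _ "Weft 0"])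
  ultimately show False using assms unfolding fabric_iff by blast
qed

lemma fabric_row_nonconstant:
  assumes "fabric D" shows "\<exists>i. D (i, j) \<noteq> D (i + 1, j)"
proof (rule ccontr)
  assume "\<not> ?thesis"
  then have step: "D (i, j) = D (i + 1, j)" for i by blast
  have const: "D (i, j) = D (0, j)" for i
  proof (induction i rule: int_induct[where k = 0])
    case (step2 k) then show ?case using step[of "k - 1"] by simp
  qed (use step in auto)
  let ?A = "if D (0, j) then - {Weft j} else {Weft j}"
  have "passes_over D s t" if "s \<in> ?A" "t \<in> - ?A" for s t
    using that const by (auto simp: passes_over_def doubleton_eq_iff split: if_splits)
  moreover have "?A \<noteq> {}" "- ?A \<noteq> {}" by (auto intro: exI[of _ "Warp 0"])
  ultimately show False using assms unfolding fabric_iff by blast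
qed

text \<open>An odd shift maps a pair of twin columns \<open>2 * x\<close>, \<open>2 * x + 1\<close> to two neighbouring columns
  that do not form a twin pair, and every such pair of neighbours arises in this way.\<close>

lemma odd_index_map_fuses:
  assumes "odd a"
  obtains x where "{index_map (r, a) (2 * x), index_map (r, a) (2 * x + 1)} = {2 * k + 1, 2 * k + 2}"
proof -
  obtain m where m: "a = 2 * m + 1" using assms by (elim oddE)
  show ?thesis
  proof (cases r)
    case True then show ?thesis using m by (intro that[of "m - k - 1"]) auto
  next
    case False then show ?thesis using m by (intro that[of "k - m"]) auto
  qed
qed

text \<open>With an odd shift, neighbours in a twin pair and neighbours in different twin pairs would both
  have to agree everywhere, which would make all rows, or all columns, constant.\<close>

lemma symmetry_of_doubled_even_shifts:
  assumes "fabric D" and sym: "(grid_map sw (r, a) (r', b), \<epsilon>) \<in> symmetry_group (doubled D)"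
  shows "even a" "even b"
proof -
  have D': "doubled D (index_map (r, a) x, index_map (r', b) y) =
      (doubled D (if sw then (y, x) else (x, y)) \<noteq> (sw \<noteq> (\<epsilon> = Reversal)))" for x y
    using sym[unfolded grid_map_symmetry_iff, rule_format, of "if sw then (y, x) else (x, y)"]
    by (auto split: if_splits simp del: index_map.simps doubled.simps)
  show "even a"
  proof (rule ccontr)
    assume "odd a"
    obtain k where k: "D (k, 0) \<noteq> D (k + 1, 0)" using fabric_row_nonconstant[OF assms(1)] by blast
    obtain x where x: "{index_map (r, a) (2 * x), index_map (r, a) (2 * x + 1)} = {2 * k + 1, 2 * k + 2}"
      using odd_index_map_fuses[OF \<open>odd a\<close>] .
    \<comment> \<open>The row that is mapped to row 0, in which the colour changes.\<close>
    define y where "y = index_map (axis_inverse (r', b)) 0"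
    have "doubled D (index_map (r, a) (2 * x), 0) = doubled D (index_map (r, a) (2 * x + 1), 0)"
      using D'[of "2 * x" y] D'[of "2 * x + 1" y] by (simp add: y_def del: index_map.simps axis_inverse.simps)
    then have "doubled D (2 * k + 1, 0) = doubled D (2 * k + 2, 0)"
      using x by (auto simp: doubleton_eq_iff simp del: index_map.simps doubled.simps)
    then show False using k by simp
  qed
  show "even b"
  proof (rule ccontr)
    assume "odd b"
    obtain k where k: "D (0, k) \<noteq> D (0, k + 1)" using fabric_column_nonconstant[OF assms(1)] by blast
    obtain y where y: "{index_map (r', b) (2 * y), index_map (r', b) (2 * y + 1)} = {2 * k + 1, 2 * k + 2}"
      using odd_index_map_fuses[OF \<open>odd b\<close>] .
    define x where "x = index_map (axis_inverse (r, a)) 0"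
    have "doubled D (0, index_map (r', b) (2 * y)) = doubled D (0, index_map (r', b) (2 * y + 1))"
      using D'[of x "2 * y"] D'[of x "2 * y + 1"] by (simp add: x_def del: index_map.simps axis_inverse.simps)
    then have "doubled D (0, 2 * k + 1) = doubled D (0, 2 * k + 2)"
      using y by (auto simp: doubleton_eq_iff simp del: index_map.simps doubled.simps)
    then show False using k by simp
  qed
qed

definition magnify :: "(complex \<Rightarrow> complex) \<Rightarrow> complex \<Rightarrow> complex" where
  "magnify g z = 2 * g (z / 2)"

lemma magnify_grid_map:
  "magnify (grid_map sw (r, a) (r', b)) = grid_map sw (r, 2 * a) (r', 2 * b)"
  by (auto simp: fun_eq_iff magnify_def grid_map_def complex_eq_iff)

lemma index_map_even_shift_div [simp]: "index_map (r, 2 * a) i div 2 = index_map (r, a) (i div 2)"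
  by auto

lemma even_shift_symmetry_iff:
  "(grid_map sw (r, 2 * a) (r', 2 * b), \<epsilon>) \<in> symmetry_group (doubled D) \<longleftrightarrow>
     (grid_map sw (r, a) (r', b), \<epsilon>) \<in> symmetry_group D"
proof -
  define P where "P i j \<longleftrightarrow>
    D (cell_map sw (r, a) (r', b) (i, j)) = (D (i, j) \<noteq> (sw \<noteq> (\<epsilon> = Reversal)))" for i j
  have "doubled D (cell_map sw (r, 2 * a) (r', 2 * b) (i, j)) =
      D (cell_map sw (r, a) (r', b) (i div 2, j div 2))" for i j
    by (simp del: index_map.simps)
  then have "(grid_map sw (r, 2 * a) (r', 2 * b), \<epsilon>) \<in> symmetry_group (doubled D) \<longleftrightarrow>
      (\<forall>i j. P (i div 2) (j div 2))"
    unfolding grid_map_symmetry_iff P_def by (simp add: split_paired_All del: cell_map.simps)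
  also have "\<dots> \<longleftrightarrow> (\<forall>i j. P i j)"
    by (metis nonzero_mult_div_cancel_left zero_neq_numeral)
  finally show ?thesis
    unfolding grid_map_symmetry_iff P_def by (simp add: split_paired_All del: cell_map.simps)
qed

lemma symmetry_group_doubled:
  assumes "fabric D"
  shows "symmetry_group (doubled D) = {(magnify g, \<epsilon>) | g \<epsilon>. (g, \<epsilon>) \<in> symmetry_group D}"
proof (intro equalityI subsetI)
  fix x assume x: "x \<in> symmetry_group (doubled D)"
  obtain h \<epsilon> where h: "x = (h, \<epsilon>)" by fastforce
  obtain sw A B where "h = grid_map sw A B" using symmetry_is_grid_map x h by metis
  then obtain r a r' b where hh: "h = grid_map sw (r, a) (r', b)" by (metis surj_pair)
  have "even a" "even b" using symmetry_of_doubled_even_shifts[OF assms] x h hh by metis+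
  then obtain a' b' where ab: "a = 2 * a'" "b = 2 * b'" by (elim evenE)
  then have "h = magnify (grid_map sw (r, a') (r', b'))" by (simp add: hh magnify_grid_map)
  moreover have "(grid_map sw (r, a') (r', b'), \<epsilon>) \<in> symmetry_group D"
    using x by (simp add: h hh ab even_shift_symmetry_iff)
  ultimately show "x \<in> {(magnify g, \<epsilon>) | g \<epsilon>. (g, \<epsilon>) \<in> symmetry_group D}"
    using h by blast
next
  fix x assume "x \<in> {(magnify g, \<epsilon>) | g \<epsilon>. (g, \<epsilon>) \<in> symmetry_group D}"
  then obtain g \<epsilon> where x: "x = (magnify g, \<epsilon>)" "(g, \<epsilon>) \<in> symmetry_group D" by blast
  moreover obtain sw A B where "g = grid_map sw A B" using symmetry_is_grid_map x by metis
  moreover obtain r a r' b where "A = (r, a)" "B = (r', b)" by fastforce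
  ultimately show "x \<in> symmetry_group (doubled D)"
    by (simp add: magnify_grid_map even_shift_symmetry_iff)
qed

lemma planar_group_doubled:
  "fabric D \<Longrightarrow> planar_group (doubled D) = magnify ` planar_group D"
  by (force simp: planar_group_def symmetry_group_doubled)

lemma magnify_inj: "magnify g = magnify h \<longleftrightarrow> g = h"
proof
  assume eq: "magnify g = magnify h"
  have "g z = h z" for z using fun_cong[OF eq, of "2 * z"] by (simp add: magnify_def)
  then show "g = h" by blast
qed simp

lemma magnify_affine: "magnify (\<lambda>z. u * z + b) = (\<lambda>z. u * z + 2 * b)"
  by (simp add: magnify_def fun_eq_iff algebra_simps)

lemma affine_mem_magnify_iff:
  "(\<lambda>z. u * z + b) \<in> magnify ` \<Gamma> \<longleftrightarrow> (\<lambda>z. u * z + b / 2) \<in> \<Gamma>"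
proof -
  have "(\<lambda>z. u * z + b) = magnify (\<lambda>z. u * z + b / 2)" by (simp add: magnify_affine)
  then show ?thesis by (auto simp: magnify_inj)
qed

fun half :: "strand \<Rightarrow> strand" where
  "half (Warp i) = Warp (i div 2)"
| "half (Weft j) = Weft (j div 2)"

lemma passes_over_iff:
  "passes_over D (Warp i) (Weft j) \<longleftrightarrow> D (i, j)"
  "passes_over D (Weft j) (Warp i) \<longleftrightarrow> \<not> D (i, j)"
  "passes_over D (Warp i) (Warp k)"
  "passes_over D (Weft j) (Weft l)"
  by (auto simp: passes_over_def doubleton_eq_iff)

lemma passes_over_doubled: "passes_over (doubled D) s t \<longleftrightarrow> passes_over D (half s) (half t)"
  by (cases s; cases t) (simp_all add: passes_over_iff)

lemma half_section_exists: "\<exists>f. \<forall>s. half (f s) = s"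
proof (intro choice allI)
  fix s
  have "half (case s of Warp i \<Rightarrow> Warp (2 * i) | Weft j \<Rightarrow> Weft (2 * j)) = s"
    by (cases s) simp_all
  then show "\<exists>t. half t = s" by blast
qed

text \<open>Suppose that \<open>A\<close> lies over its complement. Choosing one copy of each strand of the original
  transfers this to the original, which is a fabric; so every choice lies wholly inside or wholly
  outside \<open>A\<close>. A copy in \<open>A\<close> and a copy outside could be chosen together unless they are twins, and
  a third strand, crossing both, is a twin of neither.\<close>

lemma fabric_doubled:
  assumes "fabric D" shows "fabric (doubled D)"
  unfolding fabric_iff
proof (intro allI impI, rule ccontr)
  fix A :: "strand set"
  assume "A \<noteq> {}" "- A \<noteq> {}" and "\<not> (\<exists>s\<in>A. \<exists>t\<in>- A. \<not> passes_over (doubled D) s t)"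
  then have over: "passes_over D (half s) (half t)" if "s \<in> A" "t \<notin> A" for s t
    using that passes_over_doubled by blast
  have twins: "half a = half b" if a: "a \<in> A" and b: "b \<notin> A" for a b
  proof (rule ccontr)
    assume ne: "half a \<noteq> half b"
    obtain f0 where f0: "\<And>s. half (f0 s) = s" using half_section_exists by blast
    define f where "f = f0(half a := a, half b := b)"
    have f: "half (f s) = s" for s by (simp add: f_def f0)
    have "f (half a) \<in> A" "f (half b) \<notin> A" using a b ne by (auto simp: f_def)
    then have "{s. f s \<in> A} \<noteq> {}" "- {s. f s \<in> A} \<noteq> {}" by blast+
    then obtain s t where "f s \<in> A" "f t \<notin> A" "\<not> passes_over D s t"
      using assms unfolding fabric_iff by blast
    then show False using over[of "f s" "f t"] by (simp add: f)
  qed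
  obtain a b where ab: "a \<in> A" "b \<notin> A" using \<open>A \<noteq> {}\<close> \<open>- A \<noteq> {}\<close> by blast
  obtain c where c: "half c \<noteq> half a" by (cases a) (metis half.simps strand.distinct(1))+
  show False using twins[OF ab] twins[of c b] twins[of a c] ab c by (cases "c \<in> A") auto
qed

section \<open>Isonemality of a doubled fabric\<close>

definition carries :: "design \<Rightarrow> strand \<Rightarrow> strand \<Rightarrow> bool" where
  "carries D s t \<longleftrightarrow> (\<exists>g \<epsilon>. (g, \<epsilon>) \<in> symmetry_group D \<and> g ` region s = region t)"

lemma isonemal_iff_carries: "isonemal D \<longleftrightarrow> (\<forall>s t. carries D s t)"
  by (simp add: isonemal_def carries_def)

lemma carries_grid_map:
  "(grid_map sw A B, \<epsilon>) \<in> symmetry_group D \<Longrightarrow> carries D s (strand_map sw A B s)"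
  unfolding carries_def grid_map_region[symmetric] by blast

lemma carriesE:
  assumes "carries D s t"
  obtains sw A B \<epsilon> where "(grid_map sw A B, \<epsilon>) \<in> symmetry_group D" "strand_map sw A B s = t"
proof -
  obtain g \<epsilon> where g: "(g, \<epsilon>) \<in> symmetry_group D" "g ` region s = region t"
    using assms unfolding carries_def by blast
  moreover obtain sw A B where "g = grid_map sw A B" using symmetry_is_grid_map[OF g(1)] .
  ultimately show ?thesis using that by (metis grid_map_region region_inj)
qed

lemma carries_trans: "carries D s t \<Longrightarrow> carries D t u \<Longrightarrow> carries D s u"
  unfolding carries_def by (metis (no_types, lifting) image_comp symmetry_comp)

lemma strand_map_even_shifts:
  "half (strand_map sw (r, 2 * a) (r', 2 * b) s) = strand_map sw (r, a) (r', b) (half s)"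
  by (cases s) (simp_all del: index_map.simps)

lemma strand_map_surj: "\<exists>s. strand_map sw A B s = t"
proof (cases t)
  case (Warp i)
  then show ?thesis
    by (intro exI[of _ "(if sw then Weft else Warp) (index_map (axis_inverse A) i)"]) simp
next
  case (Weft j)
  then show ?thesis
    by (intro exI[of _ "(if sw then Warp else Weft) (index_map (axis_inverse B) j)"]) simp
qed

lemma strand_map_inj: "strand_map sw A B s = strand_map sw A B t \<Longrightarrow> s = t"
  by (cases s; cases t) (auto split: if_splits dest: arg_cong[where f = "index_map (axis_inverse A)"]
     arg_cong[where f = "index_map (axis_inverse B)"])

text \<open>The symmetries of the original lift to the doubled fabric, where they decide the image of a
  strand up to its twin. Chains of lifted symmetries are built from both ends, so that sometimes the
  source and sometimes the target is prescribed.\<close>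

lemma carries_doubled:
  assumes "carries D s t"
  shows "half s' = s \<Longrightarrow> \<exists>t'. half t' = t \<and> carries (doubled D) s' t'"
    and "half t' = t \<Longrightarrow> \<exists>s'. half s' = s \<and> carries (doubled D) s' t'"
proof -
  obtain sw A B \<epsilon> where g: "(grid_map sw A B, \<epsilon>) \<in> symmetry_group D" "strand_map sw A B s = t"
    using carriesE[OF assms] .
  obtain r a r' b where AB: "A = (r, a)" "B = (r', b)" by fastforce
  let ?f = "strand_map sw (r, 2 * a) (r', 2 * b)"
  have "(grid_map sw (r, 2 * a) (r', 2 * b), \<epsilon>) \<in> symmetry_group (doubled D)"
    using g(1) by (simp add: AB even_shift_symmetry_iff)
  then have c: "carries (doubled D) x (?f x)" for x by (rule carries_grid_map)
  have h: "half (?f x) = strand_map sw A B (half x)" for x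
    by (simp add: strand_map_even_shifts AB)
  show "\<exists>t'. half t' = t \<and> carries (doubled D) s' t'" if "half s' = s"
    using c[of s'] h[of s'] that g(2) by auto
  show "\<exists>s'. half s' = s \<and> carries (doubled D) s' t'" if "half t' = t"
  proof -
    obtain x where x: "?f x = t'" using strand_map_surj by blast
    then have "strand_map sw A B (half x) = strand_map sw A B s" using h[of x] that g(2) by simp
    then have "half x = s" by (rule strand_map_inj)
    then show ?thesis using c[of x] x by auto
  qed
qed

lemma half_turn_eq_grid_map:
  "(\<lambda>z. - z + Complex (of_int m) (of_int n)) = grid_map False (True, m) (True, n)"
  by (auto simp: grid_map_def complex_eq_iff)

text \<open>If \<open>m\<close> or \<open>n\<close> is odd, the half-turn fixes a strand \<open>f\<close> of the original and exchanges its
  two copies. Every strand of the doubled fabric can be carried to a copy of \<open>f\<close> and every one can be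
  reached from a copy of \<open>f\<close>, so the exchange closes the only gap.\<close>

lemma isonemal_doubledI:
  assumes iso: "isonemal D"
    and turn: "(\<lambda>z. - z + Complex (of_int m) (of_int n)) \<in> planar_group D"
    and odd: "odd m \<or> odd n"
  shows "isonemal (doubled D)"
proof -
  obtain \<epsilon> where "(grid_map False (True, m) (True, n), \<epsilon>) \<in> symmetry_group D"
    using turn unfolding half_turn_eq_grid_map planar_group_def by auto
  then have "(grid_map False (True, 2 * m) (True, 2 * n), \<epsilon>) \<in> symmetry_group (doubled D)"
    by (simp add: even_shift_symmetry_iff)
  then have swap: "carries (doubled D) s (strand_map False (True, 2 * m) (True, 2 * n) s)" for s
    by (rule carries_grid_map)
  obtain f where f: "half x = f \<Longrightarrow> half y = f \<Longrightarrow> x \<noteq> y \<Longrightarrow> carries (doubled D) x y" for x y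
  proof (cases "odd m")
    case True
    have "carries (doubled D) x y"
      if xy: "half x = Warp (m div 2)" "half y = Warp (m div 2)" "x \<noteq> y" for x y
    proof -
      obtain i j where ij: "x = Warp i" "y = Warp j" using xy by (cases x; cases y) auto
      have "j = 2 * m - 1 - i" using xy True unfolding ij by simp presburger
      then show ?thesis using swap[of x] by (simp add: ij)
    qed
    then show ?thesis using that by blast
  next
    case False
    have "carries (doubled D) x y"
      if xy: "half x = Weft (n div 2)" "half y = Weft (n div 2)" "x \<noteq> y" for x y
    proof -
      obtain i j where ij: "x = Weft i" "y = Weft j" using xy by (cases x; cases y) auto
      have "j = 2 * n - 1 - i" using xy False odd unfolding ij by simp presburger
      then show ?thesis using swap[of x] by (simp add: ij)
    qed
    then show ?thesis using that by blast
  qed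
  have "carries (doubled D) s t" for s t
  proof -
    have "carries D (half s) f" "carries D f (half t)" using iso isonemal_iff_carries by blast+
    then obtain x y where "half x = f" "carries (doubled D) s x" "half y = f" "carries (doubled D) y t"
      using carries_doubled by blast
    then show ?thesis using f[of x y] carries_trans by (cases "x = y") blast+
  qed
  then show ?thesis by (simp add: isonemal_iff_carries)
qed

text \<open>A symmetry that carries a strand to its twin exchanges the two halves of the original strand.
  It reverses the coordinate across the strand, and since the group has type \<open>p4\<close> it is a rotation,
  so it is a half-turn rather than a reflection.\<close>

lemma isonemal_doubledD:
  assumes "fabric D" and p4: "type_p4 (planar_group D)" and iso: "isonemal (doubled D)"
  obtains m n where "(\<lambda>z. - z + Complex (of_int m) (of_int n)) \<in> planar_group D" "odd m"
proof -
  have "carries (doubled D) (Warp 0) (Warp 1)" using iso isonemal_iff_carries by blast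
  then obtain sw A B \<epsilon> where h: "(grid_map sw A B, \<epsilon>) \<in> symmetry_group (doubled D)"
    and f: "strand_map sw A B (Warp 0) = Warp 1"
    by (rule carriesE)
  obtain r a r' b where AB: "A = (r, a)" "B = (r', b)" by fastforce
  obtain a' b' where ab: "a = 2 * a'" "b = 2 * b'"
    using symmetry_of_doubled_even_shifts[OF assms(1)] h AB by (metis evenE)
  have "\<not> sw" using f by (auto split: if_splits)
  moreover have "r" "a' = 1" using f \<open>\<not> sw\<close> by (auto simp: AB ab split: if_splits, presburger+)
  ultimately have "(grid_map False (True, 1) (r', b'), \<epsilon>) \<in> symmetry_group D"
    using h even_shift_symmetry_iff[of False True 1 r' b'] by (simp add: AB ab)
  then have g: "grid_map False (True, 1) (r', b') \<in> planar_group D"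
    unfolding planar_group_def by force
  then obtain u c where u: "grid_map False (True, 1) (r', b') = (\<lambda>z. u * z + c)"
    using p4 unfolding type_p4_def by blast
  have "grid_map False (True, 1) (r', b') = (\<lambda>z. - z + Complex (of_int 1) (of_int b'))"
  proof -
    have c: "c = Complex 1 (of_int b')"
      using fun_cong[OF u, of 0] by (auto simp: grid_map_def complex_eq_iff split: if_splits)
    have "u = - 1"
      using fun_cong[OF u, of 1] by (auto simp: c grid_map_def complex_eq_iff split: if_splits)
    then show ?thesis by (simp add: u c)
  qed
  then show ?thesis using g that[of 1 b'] by simp
qed

section \<open>The sides of units of a given level\<close>

text \<open>The possible sides of units of level 1, which are generalised knight moves.\<close>

definition knight_vector :: "complex \<Rightarrow> bool" where
  "knight_vector w \<longleftrightarrow> (\<exists>a b :: int. a \<noteq> 0 \<and> b \<noteq> 0 \<and> odd (a + b) \<and> w = Complex (of_int a) (of_int b))"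

lemma knight_vector_rotate: "knight_vector w \<Longrightarrow> knight_vector (\<i> * w)"
proof -
  assume "knight_vector w"
  then obtain a b :: int where "a \<noteq> 0" "b \<noteq> 0" "odd (a + b)" "w = Complex (of_int a) (of_int b)"
    unfolding knight_vector_def by blast
  then show ?thesis unfolding knight_vector_def
    by (intro exI[of _ "- b"] exI[of _ a]) (auto simp: complex_eq_iff)
qed

lemma knight_vector_unit:
  assumes "knight_vector w" "e \<in> {1, \<i>, - 1, - \<i>}"
  shows "knight_vector (e * w)"
proof -
  have "knight_vector (\<i> * w)" "knight_vector (\<i> * (\<i> * w))" "knight_vector (\<i> * (\<i> * (\<i> * w)))"
    using assms(1) knight_vector_rotate by blast+
  moreover have "\<i> * (\<i> * w) = - w" "\<i> * (\<i> * (\<i> * w)) = - (\<i> * w)"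
    by (simp_all add: complex_eq_iff)
  ultimately show ?thesis using assms by auto
qed

text \<open>A square determines its side up to the choice of the corner from which it is drawn: writing the
  corners in the coordinates of the second square leaves finitely many cases.\<close>

lemma sq_corners_side:
  assumes "sq_corners p v = sq_corners q w"
  shows "v \<in> {w, \<i> * w, - w, - (\<i> * w)}"
proof -
  define S where "S = {0, 1, 1 + \<i>, \<i>}"
  have S: "\<exists>\<alpha>\<in>S. z = q + \<alpha> * w" if "z \<in> sq_corners p v" for z
    using that unfolding assms by (auto simp: sq_corners_def S_def algebra_simps)
  obtain \<alpha> \<beta> \<gamma> where mem: "\<alpha> \<in> S" "\<beta> \<in> S" "\<gamma> \<in> S"
    and "p = q + \<alpha> * w" "p + v = q + \<beta> * w" "p + \<i> * v = q + \<gamma> * w"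
    using S[of p] S[of "p + v"] S[of "p + \<i> * v"] by (auto simp: sq_corners_def)
  then have v: "v = (\<beta> - \<alpha>) * w" "\<i> * v = (\<gamma> - \<alpha>) * w" by (auto simp: algebra_simps)
  show ?thesis
  proof (cases "v = 0")
    case True
    then have "sq_corners p v = {p}" by (simp add: sq_corners_def)
    then have "sq_corners q w = {p}" using assms by simp
    then have "q = p" "q + w = p" unfolding sq_corners_def by blast+
    then have "w = 0" by simp
    then show ?thesis using True by simp
  next
    case False
    then have "w \<noteq> 0" using v by auto
    then have "\<i> * (\<beta> - \<alpha>) = \<gamma> - \<alpha>" using v by (metis mult.assoc mult_right_cancel)
    then have "\<beta> - \<alpha> \<in> {0, 1, \<i>, - 1, - \<i>}"
      using mem unfolding S_def by (elim insertE emptyE) (simp_all add: complex_eq_iff)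
    then show ?thesis using v False by auto
  qed
qed

lemma sq_midpoints_eq_corners: "sq_midpoints p v = sq_corners (p + v / 2) ((1 + \<i>) * v / 2)"
proof -
  have "p + v / 2 + (1 + \<i>) * v / 2 = p + v + \<i> * v / 2"
    "p + v / 2 + (1 + \<i>) * v / 2 + \<i> * ((1 + \<i>) * v / 2) = p + v / 2 + \<i> * v"
    "p + v / 2 + \<i> * ((1 + \<i>) * v / 2) = p + \<i> * v / 2"
    by (simp_all add: complex_eq_iff field_simps)
  then show ?thesis unfolding sq_midpoints_def sq_corners_def by (simp only:)
qed

text \<open>By \<open>sq_midpoints_eq_corners\<close> the inscribed square of a square of side \<open>v\<close> has side
  \<open>(1 + \<i>) * v / 2\<close>, and \<open>2 / (1 + \<i>) = 1 - \<i>\<close>. The ambiguity of the side by a power of \<open>\<i>\<close> is absorbed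
  into the vector \<open>w\<close>.\<close>

lemma unit_of_level_side:
  assumes "unit_of_level n p v"
  shows "\<exists>k w. n = Suc k \<and> knight_vector w \<and> v = (1 - \<i>) ^ k * w"
  using assms
proof induction
  case (base a b v p)
  obtain x where x: "Re v = of_int x" "\<bar>x\<bar> = int a"
    using base.hyps(4) by (cases "Re v \<ge> 0") (auto intro: that[of "int a"] that[of "- int a"])
  obtain y where y: "Im v = of_int y" "\<bar>y\<bar> = int b"
    using base.hyps(5) by (cases "Im v \<ge> 0") (auto intro: that[of "int b"] that[of "- int b"])
  have "odd (x + y)" using x(2) y(2) base.hyps(3) by presburger
  moreover have "x \<noteq> 0" "y \<noteq> 0" using x y base.hyps(1,2) by auto
  moreover have "v = Complex (of_int x) (of_int y)" using x y by (simp add: complex_eq_iff)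
  ultimately have "knight_vector v" unfolding knight_vector_def by blast
  then show ?case by simp
next
  case (escribe n q w p v)
  then obtain k w0 where k: "n = Suc k" "knight_vector w0" "w = (1 - \<i>) ^ k * w0" by blast
  define d where "d = (1 + \<i>) * v / 2"
  have "d \<in> {w, \<i> * w, - w, - (\<i> * w)}"
    using escribe.hyps(2) unfolding sq_midpoints_eq_corners d_def by (rule sq_corners_side)
  moreover have "v = (1 - \<i>) * d" by (simp add: d_def complex_eq_iff field_simps)
  ultimately have "v \<in> (\<lambda>e. (1 - \<i>) * (e * w)) ` {1, \<i>, - 1, - \<i>}" by auto
  then obtain e where e: "e \<in> {1, \<i>, - 1, - \<i>}" "v = (1 - \<i>) * (e * w)" by blast
  have "knight_vector (e * w0)"
    using k(2) e(1) by (rule knight_vector_unit)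
  moreover have "v = (1 - \<i>) ^ n * (e * w0)" using e(2) k by simp
  ultimately show ?case by blast
qed

text \<open>Escribing keeps the centre, so the construction starts from the square of side \<open>w\<close> with the
  given centre. The sum and the difference of the coordinates of \<open>w\<close> are odd, hence the corners of
  that square are cell centres when its centre is a cell corner.\<close>

lemma unit_of_levelI:
  assumes "knight_vector w" "sq_centre p ((1 - \<i>) ^ k * w) \<in> cell_corners"
  shows "unit_of_level (Suc k) p ((1 - \<i>) ^ k * w)"
  using assms(2)
proof (induction k arbitrary: p)
  case 0
  obtain a b :: int where ab: "a \<noteq> 0" "b \<noteq> 0" "odd (a + b)" "w = Complex (of_int a) (of_int b)"
    using assms(1) unfolding knight_vector_def by blast
  obtain x y :: int where xy: "Re (sq_centre p w) = of_int x" "Im (sq_centre p w) = of_int y"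
    using 0 by (auto simp: cell_corners_def elim!: Ints_cases)
  \<comment> \<open>Eliminating \<open>b\<close> in favour of \<open>c\<close> makes the halves in the coordinates of the corners visible.\<close>
  obtain c where c: "a + b = 2 * c + 1" using ab(3) by (elim oddE)
  then have b: "b = 2 * c + 1 - a" by simp
  have p: "p = Complex (of_int (x - a + c) + 1 / 2) (of_int (y - c) - 1 / 2)"
    using xy by (simp add: complex_eq_iff sq_centre_def ab(4) b field_simps)
  have "sq_corners p w \<subseteq> cell_centres"
    unfolding p sq_corners_def cell_centres_def ab(4) b by auto
  then have "unit_of_level 1 p w"
    using ab by (intro unit_of_level.base[of "nat \<bar>a\<bar>" "nat \<bar>b\<bar>"]) (auto simp: even_nat_iff)
  then show ?case by simp
next
  case (Suc k)
  let ?v = "(1 - \<i>) ^ Suc k * w"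
  have w: "(1 + \<i>) * ?v / 2 = (1 - \<i>) ^ k * w" by (simp add: field_simps flip: mult.assoc)
  have "sq_centre (p + ?v / 2) ((1 + \<i>) * ?v / 2) = sq_centre p ?v"
    by (simp add: sq_centre_def complex_eq_iff field_simps)
  then have "unit_of_level (Suc k) (p + ?v / 2) ((1 + \<i>) * ?v / 2)"
    using Suc.IH[of "p + ?v / 2"] Suc.prems unfolding w by simp
  then show ?case by (rule unit_of_level.escribe) (rule sq_midpoints_eq_corners)
qed

lemma cell_corners_closed:
  "x \<in> cell_corners \<Longrightarrow> y \<in> cell_corners \<Longrightarrow> x + y \<in> cell_corners"
  "x \<in> cell_corners \<Longrightarrow> y \<in> cell_corners \<Longrightarrow> x * y \<in> cell_corners"
  "1 - \<i> \<in> cell_corners" "1 + \<i> \<in> cell_corners" "2 \<in> cell_corners"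
  by (auto simp: cell_corners_def)

lemma cell_corner_coords: "p \<in> cell_corners \<Longrightarrow> \<exists>x y. p = Complex (of_int x) (of_int y)"
  by (metis (mono_tags, lifting) Ints_cases cell_corners_def complex.exhaust_sel mem_Collect_eq)

lemma knight_vector_cell_corner: "knight_vector w \<Longrightarrow> w \<in> cell_corners"
  by (auto simp: knight_vector_def cell_corners_def)

lemma power_cell_corners: "x \<in> cell_corners \<Longrightarrow> x ^ k \<in> cell_corners"
  by (induction k) (auto simp: cell_corners_closed, simp add: cell_corners_def)

lemma unit_of_level_side_cell_corner:
  assumes "unit_of_level n p v" shows "v \<in> cell_corners"
proof -
  obtain k w where "knight_vector w" "v = (1 - \<i>) ^ k * w" using unit_of_level_side[OF assms] by blast
  then show ?thesis by (simp add: cell_corners_closed power_cell_corners knight_vector_cell_corner)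
qed

text \<open>The magnified unit is not obtained by magnifying the chain of inscribed squares: its level-1
  square is concentric with it and only as large as that of the original.\<close>

lemma unit_of_level_magnify:
  assumes "unit_of_level n p v" "2 * p \<in> cell_corners"
  shows "unit_of_level (n + 2) (2 * p) (2 * v)"
proof -
  obtain k w where k: "n = Suc k" "knight_vector w" "v = (1 - \<i>) ^ k * w"
    using unit_of_level_side[OF assms(1)] by blast
  have "(1 - \<i>)\<^sup>2 * \<i> = 2" by (simp add: complex_eq_iff power2_eq_square)
  moreover have "(1 - \<i>) ^ (k + 2) * (\<i> * w) = (1 - \<i>) ^ k * w * ((1 - \<i>)\<^sup>2 * \<i>)"
    by (simp only: power_add mult_ac)
  ultimately have v: "2 * v = (1 - \<i>) ^ (k + 2) * (\<i> * w)" by (simp add: k(3))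
  have "sq_centre (2 * p) (2 * v) = 2 * p + (1 + \<i>) * v"
    by (simp add: sq_centre_def algebra_simps)
  also have "\<dots> \<in> cell_corners"
    using assms unit_of_level_side_cell_corner by (auto intro!: cell_corners_closed)
  finally have "unit_of_level (Suc (k + 2)) (2 * p) (2 * v)"
    unfolding v using knight_vector_rotate[OF k(2)] by (rule unit_of_levelI[rotated])
  then show ?thesis by (simp add: k(1))
qed

text \<open>The prime \<open>1 - \<i>\<close> does not divide a generalised knight move, and its square is 2 up to a
  unit; it divides the side of a unit of level \<open>n\<close> exactly \<open>n - 1\<close> times.\<close>

lemma unit_of_level_parity:
  assumes "unit_of_level n p v"
  shows "n = 1 \<Longrightarrow> \<exists>x y. v = Complex (of_int x) (of_int y) \<and> odd (x + y)"
    and "n = 2 \<Longrightarrow> \<exists>x y. v = Complex (of_int x) (of_int y) \<and> odd x \<and> odd y"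
    and "n \<ge> 3 \<Longrightarrow> \<exists>x y. v = Complex (of_int (2 * x)) (of_int (2 * y))"
proof -
  obtain k w where k: "n = Suc k" "knight_vector w" "v = (1 - \<i>) ^ k * w"
    using unit_of_level_side[OF assms] by blast
  obtain a b :: int where ab: "odd (a + b)" "w = Complex (of_int a) (of_int b)"
    using k(2) unfolding knight_vector_def by blast
  show "n = 1 \<Longrightarrow> \<exists>x y. v = Complex (of_int x) (of_int y) \<and> odd (x + y)"
    using k ab by auto
  show "n = 2 \<Longrightarrow> \<exists>x y. v = Complex (of_int x) (of_int y) \<and> odd x \<and> odd y"
    using k ab by (intro exI[of _ "a + b"] exI[of _ "b - a"]) (auto simp: complex_eq_iff)
  show "\<exists>x y. v = Complex (of_int (2 * x)) (of_int (2 * y))" if "n \<ge> 3"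
  proof -
    define l where "l = k - 2"
    have l: "k = l + 2" using that k(1) by (simp add: l_def)
    have "(1 - \<i>)\<^sup>2 = 2 * (- \<i>)" by (simp add: complex_eq_iff power2_eq_square)
    then have "(1 - \<i>) ^ k = (1 - \<i>) ^ l * (2 * (- \<i>))" unfolding l power_add by (rule arg_cong)
    then have v: "v = 2 * (- \<i> * (1 - \<i>) ^ l * w)" by (simp add: k(3))
    have "- \<i> \<in> cell_corners" by (simp add: cell_corners_def)
    then have "- \<i> * (1 - \<i>) ^ l * w \<in> cell_corners"
      by (intro cell_corners_closed(2,3) power_cell_corners knight_vector_cell_corner[OF k(2)])
    then obtain x y where "- \<i> * (1 - \<i>) ^ l * w = Complex (of_int x) (of_int y)"
      using cell_corner_coords by blast
    then show ?thesis using v by (intro exI[of _ x] exI[of _ y]) (simp add: complex_eq_iff)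
  qed
qed

section \<open>Lattice units and quarter-turns under magnification\<close>

lemma translation_vectors_magnify: "translation_vectors (magnify ` \<Gamma>) = (*) 2 ` translation_vectors \<Gamma>"
proof -
  have "b \<in> translation_vectors (magnify ` \<Gamma>) \<longleftrightarrow> b / 2 \<in> translation_vectors \<Gamma>" for b
    using affine_mem_magnify_iff[of 1 b \<Gamma>] by (simp add: translation_vectors_def)
  then show ?thesis by (force simp: image_iff)
qed

lemma lattice_magnify: "lattice (2 * v) (2 * w) = (*) 2 ` lattice v w"
proof -
  have "of_int m * (2 * v) + of_int n * (2 * w) = 2 * (of_int m * v + of_int n * w)" for m n
    by (simp add: algebra_simps)
  then show ?thesis unfolding lattice_def by (simp only:) blast
qed

lemma type_p4_magnify:
  assumes "type_p4 \<Gamma>" shows "type_p4 (magnify ` \<Gamma>)"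
proof -
  obtain v w where vw: "v \<noteq> w" "independent {v, w}" "translation_vectors \<Gamma> = lattice v w"
    using assms unfolding type_p4_def by blast
  have lin: "linear ((*) (2 :: complex))" by (rule linearI) (simp_all add: algebra_simps)
  have "independent ((*) 2 ` {v, w})"
    using vw(2) lin by (intro linear_independent_injective_image) (auto simp: inj_on_def)
  then have "2 * v \<noteq> 2 * w \<and> independent {2 * v, 2 * w} \<and>
      translation_vectors (magnify ` \<Gamma>) = lattice (2 * v) (2 * w)"
    using vw by (simp add: translation_vectors_magnify lattice_magnify)
  then have "\<exists>v w. v \<noteq> w \<and> independent {v, w} \<and> translation_vectors (magnify ` \<Gamma>) = lattice v w"
    by blast
  moreover have "\<exists>u b. h = (\<lambda>z. u * z + b)" if h: "h \<in> magnify ` \<Gamma>" for h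
  proof -
    obtain g where "g \<in> \<Gamma>" "h = magnify g" using h by blast
    moreover from this obtain u b where "g = (\<lambda>z. u * z + b)" using assms unfolding type_p4_def by blast
    ultimately have "h = magnify (\<lambda>z. u * z + b)" by simp
    then show ?thesis unfolding magnify_affine by blast
  qed
  moreover have "(\<exists>b. (\<lambda>z. u * z + b) \<in> magnify ` \<Gamma>) \<longleftrightarrow> (\<exists>b. (\<lambda>z. u * z + b) \<in> \<Gamma>)" for u
    unfolding affine_mem_magnify_iff by (metis nonzero_mult_div_cancel_left zero_neq_numeral)
  moreover have "{u. \<exists>b. (\<lambda>z. u * z + b) \<in> \<Gamma>} = {1, \<i>, - 1, - \<i>}"
    using assms unfolding type_p4_def by blast
  ultimately show ?thesis unfolding type_p4_def by simp
qed

lemma quarter_turns_about_magnify: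
  "quarter_turns_about (magnify ` \<Gamma>) (2 * q) = magnify ` quarter_turns_about \<Gamma> q"
proof -
  have "(\<lambda>z. 2 * q + \<i> * (z - 2 * q)) = magnify (\<lambda>z. q + \<i> * (z - q))"
    "(\<lambda>z. 2 * q - \<i> * (z - 2 * q)) = magnify (\<lambda>z. q - \<i> * (z - q))"
    by (simp_all add: magnify_def fun_eq_iff algebra_simps)
  then show ?thesis unfolding quarter_turns_about_def by (auto simp: magnify_inj)
qed

lemma sq_corners_magnify: "sq_corners (2 * p) (2 * v) = (*) 2 ` sq_corners p v"
  by (simp add: sq_corners_def algebra_simps)

lemma sq_centre_magnify: "sq_centre (2 * p) (2 * v) = 2 * sq_centre p v"
  by (simp add: sq_centre_def algebra_simps)

lemma lattice_unit_magnify: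
  assumes "lattice_unit \<Gamma> p v" shows "lattice_unit (magnify ` \<Gamma>) (2 * p) (2 * v)"
  using assms lattice_magnify[of v "\<i> * v"] unfolding lattice_unit_def sq_corners_magnify
  by (auto simp: translation_vectors_magnify quarter_turns_about_magnify mult.left_commute)

lemma p4_unit_doubled:
  assumes "fabric D" "p4_unit D n p v" "2 * p \<in> cell_corners"
  shows "p4_unit (doubled D) (n + 2) (2 * p) (2 * v)"
    and "centre_and_corners_in cell_corners (2 * p) (2 * v)"
proof -
  show "p4_unit (doubled D) (n + 2) (2 * p) (2 * v)"
    using assms unfolding p4_unit_def planar_group_doubled[OF assms(1)]
    using type_p4_magnify lattice_unit_magnify unit_of_level_magnify by blast
  have v: "v \<in> cell_corners"
    using assms(2) unit_of_level_side_cell_corner unfolding p4_unit_def by blast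
  have "sq_centre (2 * p) (2 * v) = 2 * p + (1 + \<i>) * v"
    by (simp add: sq_centre_def algebra_simps)
  moreover have "sq_corners (2 * p) (2 * v) =
      {2 * p, 2 * p + 2 * v, 2 * p + 2 * (1 + \<i>) * v, 2 * p + (2 * (1 + \<i>) - 2) * v}"
    by (simp add: sq_corners_def algebra_simps)
  moreover have "2 * (1 + \<i>) - 2 \<in> cell_corners" by (simp add: cell_corners_def)
  ultimately show "centre_and_corners_in cell_corners (2 * p) (2 * v)"
    using assms(3) v unfolding centre_and_corners_in_def by (auto intro!: cell_corners_closed)
qed

lemma preserving_doubled: "fabric D \<Longrightarrow> preserving (doubled D) (magnify g) \<longleftrightarrow> preserving D g"
  by (auto simp: preserving_def symmetry_group_doubled magnify_inj)

lemma reversing_doubled: "fabric D \<Longrightarrow> reversing (doubled D) (magnify g) \<longleftrightarrow> reversing D g"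
  by (auto simp: reversing_def symmetry_group_doubled magnify_inj)

lemma turns_preserving_doubled:
  assumes "fabric D" shows "turns_preserving (doubled D) ((*) 2 ` S) \<longleftrightarrow> turns_preserving D S"
  by (simp add: turns_preserving_def planar_group_doubled quarter_turns_about_magnify
      preserving_doubled assms)

lemma turns_reversing_doubled:
  assumes "fabric D" shows "turns_reversing (doubled D) ((*) 2 ` S) \<longleftrightarrow> turns_reversing D S"
  by (simp add: turns_reversing_def planar_group_doubled quarter_turns_about_magnify
      reversing_doubled assms)

lemma range_times_2: "range ((*) (2 :: complex)) = UNIV"
  by (metis surj_def nonzero_mult_div_cancel_left times_divide_eq_right zero_neq_numeral)

section \<open>Half-turns of the group and the level of its unit\<close>

lemma half_turn_about_corner:
  assumes "lattice_unit (planar_group D) p v"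
  shows "(\<lambda>z. - z + 2 * p) \<in> planar_group D"
proof -
  obtain g where g: "g \<in> quarter_turns_about (planar_group D) p"
    using assms unfolding lattice_unit_def sq_corners_def by blast
  then have "g \<circ> g = (\<lambda>z. - z + 2 * p)"
    unfolding quarter_turns_about_def by (auto simp: fun_eq_iff complex_eq_iff)
  moreover have "g \<in> planar_group D" using g unfolding quarter_turns_about_def by blast
  ultimately show ?thesis using planar_group_comp by metis
qed

lemma half_turn_about_midpoint:
  assumes "lattice_unit (planar_group D) p v"
  shows "(\<lambda>z. - z + (2 * p + v)) \<in> planar_group D"
proof -
  have "v = of_int 1 * v + of_int 0 * (\<i> * v)" by simp
  then have "v \<in> translation_vectors (planar_group D)"
    using assms unfolding lattice_unit_def lattice_def by blast
  then have "(\<lambda>z. z + v) \<circ> (\<lambda>z. - z + 2 * p) \<in> planar_group D"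
    using half_turn_about_corner[OF assms] planar_group_comp unfolding translation_vectors_def by blast
  moreover have "(\<lambda>z. z + v) \<circ> (\<lambda>z. - z + 2 * p) = (\<lambda>z. - z + (2 * p + v))"
    by (simp add: fun_eq_iff)
  ultimately show ?thesis by simp
qed

text \<open>Two half-turns differ by a translation, so one half-turn and the lattice give them all.\<close>

lemma half_turn_centres:
  assumes unit: "lattice_unit (planar_group D) p v" and "(\<lambda>z. - z + b) \<in> planar_group D"
  obtains m n where "b = 2 * p + of_int m * v + of_int n * (\<i> * v)"
proof -
  have "(\<lambda>z. - z + b) \<circ> (\<lambda>z. - z + 2 * p) \<in> planar_group D"
    using assms half_turn_about_corner planar_group_comp by blast
  moreover have "(\<lambda>z. - z + b) \<circ> (\<lambda>z. - z + 2 * p) = (\<lambda>z. z + (b - 2 * p))"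
    by (simp add: fun_eq_iff)
  ultimately have "b - 2 * p \<in> lattice v (\<i> * v)"
    using unit unfolding lattice_unit_def translation_vectors_def by auto
  then obtain m n where "b - 2 * p = of_int m * v + of_int n * (\<i> * v)"
    unfolding lattice_def by blast
  then show ?thesis using that[of m n] by (simp add: algebra_simps)
qed

lemma cell_centre_coords:
  assumes "p \<in> cell_centres"
  shows "\<exists>x y. 2 * p = Complex (of_int (2 * x + 1)) (of_int (2 * y + 1))"
proof -
  obtain x y where "Re p - 1 / 2 = of_int x" "Im p - 1 / 2 = of_int y"
    using assms unfolding cell_centres_def by (auto elim!: Ints_cases)
  then show ?thesis by (intro exI[of _ x] exI[of _ y]) (simp add: complex_eq_iff)
qed

lemma doubled_not_isonemal:
  assumes "fabric D" "p4_unit D n p v" "n \<ge> 3" "p \<in> cell_corners"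
  shows "\<not> isonemal (doubled D)"
proof
  assume iso: "isonemal (doubled D)"
  have p4: "type_p4 (planar_group D)" "lattice_unit (planar_group D) p v" "unit_of_level n p v"
    using assms(2) unfolding p4_unit_def by auto
  obtain c d where turn: "(\<lambda>z. - z + Complex (of_int c) (of_int d)) \<in> planar_group D" "odd c"
    using isonemal_doubledD[OF assms(1) p4(1) iso] .
  obtain x y where v: "v = Complex (of_int (2 * x)) (of_int (2 * y))"
    using unit_of_level_parity(3)[OF p4(3) assms(3)] by blast
  obtain s t where p: "p = Complex (of_int s) (of_int t)" using cell_corner_coords assms(4) by blast
  obtain k l where "Complex (of_int c) (of_int d) = 2 * p + of_int k * v + of_int l * (\<i> * v)"
    using half_turn_centres[OF p4(2) turn(1)] .
  then have "real_of_int c = of_int (2 * s + k * (2 * x) - l * (2 * y))"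
    by (simp add: p v complex_eq_iff)
  then have "c = 2 * s + k * (2 * x) - l * (2 * y)" by linarith
  then show False using turn(2) by simp
qed

lemma doubled_isonemal:
  assumes "isonemal D" "p4_unit D n p v"
    and "p \<in> cell_centres \<or> p \<in> cell_corners \<and> n \<in> {1, 2}"
  shows "isonemal (doubled D)"
  using assms(3)
proof (elim disjE conjE)
  have unit: "lattice_unit (planar_group D) p v" "unit_of_level n p v"
    using assms(2) unfolding p4_unit_def by auto
  show ?thesis if "p \<in> cell_centres"
  proof -
    obtain x y where "2 * p = Complex (of_int (2 * x + 1)) (of_int (2 * y + 1))"
      using cell_centre_coords \<open>p \<in> cell_centres\<close> by blast
    then show ?thesis
      using half_turn_about_corner[OF unit(1)] isonemal_doubledI[OF assms(1), of "2 * x + 1" "2 * y + 1"]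
      by simp
  qed
  show ?thesis if "p \<in> cell_corners" "n \<in> {1, 2}"
  proof -
    obtain s t where p: "p = Complex (of_int s) (of_int t)" using cell_corner_coords \<open>p \<in> cell_corners\<close> by blast
    obtain x y where v: "v = Complex (of_int x) (of_int y)" "odd x \<or> odd y"
      using unit_of_level_parity(1,2)[OF unit(2)] \<open>n \<in> {1, 2}\<close> by fastforce
    have "2 * p + v = Complex (of_int (2 * s + x)) (of_int (2 * t + y))"
      by (simp add: p v complex_eq_iff)
    then show ?thesis
      using half_turn_about_midpoint[OF unit(1)] v(2)
        isonemal_doubledI[OF assms(1), of "2 * s + x" "2 * t + y"] by simp
  qed
qed

text \<open>Half a diagonal of a level-1 unit has both coordinates half-odd, and so leads from cell corners
  to cell centres and from cell centres to cell corners.\<close>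

lemma level_1_corners:
  assumes "unit_of_level 1 p v"
  obtains "sq_corners p v \<subseteq> cell_corners" "sq_centre p v \<in> cell_centres"
  | "sq_corners p v \<subseteq> cell_centres" "sq_centre p v \<in> cell_corners"
proof -
  have corners: "sq_corners p v \<subseteq> cell_corners \<or> sq_corners p v \<subseteq> cell_centres"
    using assms by (cases rule: unit_of_level.cases) (auto dest: unit_of_level_side)
  obtain x y :: int where v: "v = Complex (of_int x) (of_int y)" "odd (x + y)"
    using unit_of_level_parity(1)[OF assms] by blast
  obtain c where "x + y = 2 * c + 1" using v(2) by (elim oddE)
  then have x: "x = 2 * c + 1 - y" by simp
  have re: "Re (sq_centre p v) = Re p + of_int (c - y) + 1 / 2"
    and im: "Im (sq_centre p v) = Im p + of_int c + 1 / 2"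
    by (simp_all add: sq_centre_def v(1) x field_simps)
  have p: "p \<in> sq_corners p v" by (simp add: sq_corners_def)
  show ?thesis
  proof (cases "sq_corners p v \<subseteq> cell_corners")
    case True
    then have "sq_centre p v \<in> cell_centres"
      using p by (auto simp: cell_corners_def cell_centres_def re im)
    then show ?thesis using True that by blast
  next
    case False
    then have centres: "sq_corners p v \<subseteq> cell_centres" using corners by blast
    then obtain m n :: int where "Re p - 1 / 2 = of_int m" "Im p - 1 / 2 = of_int n"
      using p unfolding cell_centres_def by (auto elim!: Ints_cases)
    then have "Re (sq_centre p v) = of_int (m + c - y + 1)" "Im (sq_centre p v) = of_int (n + c + 1)"
      by (simp_all add: re im)
    then have "sq_centre p v \<in> cell_corners" by (simp add: cell_corners_def)
    then show ?thesis using centres that by blast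
  qed
qed

lemma twice_corner_or_centre:
  assumes "p \<in> cell_corners \<union> cell_centres" shows "2 * p \<in> cell_corners"
  using assms
proof
  assume "p \<in> cell_centres"
  then obtain x y where "2 * p = Complex (of_int (2 * x + 1)) (of_int (2 * y + 1))"
    using cell_centre_coords by blast
  then show ?thesis unfolding cell_corners_def by (metis Ints_of_int complex.sel mem_Collect_eq)
qed (auto simp: cell_corners_closed)

section \<open>Species of the doubled fabrics\<close>

lemma doubled_low_level:
  assumes "fabric D" "isonemal D" "p4_unit D n p v" "n \<in> {1, 2}" "p \<in> cell_corners \<union> cell_centres"
  shows "fabric (doubled D) \<and> isonemal (doubled D) \<and> p4_unit (doubled D) (n + 2) (2 * p) (2 * v) \<and>
    centre_and_corners_in cell_corners (2 * p) (2 * v)"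
  using assms fabric_doubled doubled_isonemal p4_unit_doubled twice_corner_or_centre by blast

lemma corner_in_sq_corners: "p \<in> sq_corners p v"
  by (simp add: sq_corners_def)

lemma level_1_corner_in_grid: "unit_of_level 1 p v \<Longrightarrow> p \<in> cell_corners \<union> cell_centres"
  by (metis UnCI corner_in_sq_corners level_1_corners subsetD)

lemma turns_preserving_UNIV_doubled:
  "fabric D \<Longrightarrow> turns_preserving (doubled D) UNIV \<longleftrightarrow> turns_preserving D UNIV"
  using turns_preserving_doubled[of D UNIV] by (simp add: range_times_2)

lemma turns_reversing_UNIV_doubled:
  "fabric D \<Longrightarrow> turns_reversing (doubled D) UNIV \<longleftrightarrow> turns_reversing D UNIV"
  using turns_reversing_doubled[of D UNIV] by (simp add: range_times_2)

lemma species_34_doubled: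
  assumes "fabric D" "isonemal D" "species_34 D"
  shows "fabric (doubled D) \<and> isonemal (doubled D) \<and> species_33 (doubled D)"
proof -
  obtain p v where unit: "p4_unit D 2 p v" "centre_and_corners_in cell_corners p v"
    and turns: "turns_preserving D UNIV"
    using assms(3) unfolding species_34_def by blast
  have "p \<in> cell_corners \<union> cell_centres"
    using unit(2) corner_in_sq_corners unfolding centre_and_corners_in_def by blast
  note doubled = doubled_low_level[OF assms(1,2) unit(1) _ this, simplified]
  then have "species_33_level 4 (doubled D)"
    using turns assms(1) unfolding species_33_level_def by (auto simp: turns_preserving_UNIV_doubled)
  then show ?thesis using doubled by (simp add: species_33_def)
qed

lemma species_36_doubled:
  assumes "fabric D" "isonemal D" "species_36 D"
  shows "fabric (doubled D) \<and> isonemal (doubled D) \<and> species_35 (doubled D)"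
proof -
  obtain n p v where unit: "p4_unit D n p v" "n \<in> {1, 2}" "p \<in> cell_corners \<union> cell_centres"
    and turns: "turns_reversing D UNIV"
  proof -
    consider p v where "p4_unit D 1 p v" "turns_reversing D UNIV"
      | p v where "p4_unit D 2 p v" "p \<in> cell_corners \<union> cell_centres" "turns_reversing D UNIV"
      using assms(3) corner_in_sq_corners
      unfolding species_36_def species_36_1_def species_36_2_def species_36_s_def
        centre_and_corners_in_def by blast
    then show ?thesis
    proof cases
      case 1
      then show ?thesis using that level_1_corner_in_grid unfolding p4_unit_def by blast
    next
      case 2
      then show ?thesis using that by blast
    qed
  qed
  note doubled = doubled_low_level[OF assms(1,2) unit]
  then have "species_35_level (n + 2) (doubled D)"
    using turns assms(1) unfolding species_35_level_def by (auto simp: turns_reversing_UNIV_doubled)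
  moreover have "n + 2 = 3 \<or> n + 2 = 4" using unit(2) by auto
  ultimately have "species_35 (doubled D)" unfolding species_35_def by metis
  then show ?thesis using doubled by simp
qed

lemma turns_mono:
  "turns_preserving D T \<Longrightarrow> S \<subseteq> T \<Longrightarrow> turns_preserving D S"
  "turns_reversing D T \<Longrightarrow> S \<subseteq> T \<Longrightarrow> turns_reversing D S"
  by (auto simp: turns_preserving_def turns_reversing_def)

text \<open>The centre and the corners of a level-1 unit lie in different classes, one of preserving and one
  of reversing quarter-turns; which is which depends on the unit, and the mixed species allow both.\<close>

lemma species_39_doubled:
  assumes "fabric D" "isonemal D" "species_39 D"
  shows "fabric (doubled D) \<and> isonemal (doubled D) \<and> species_38 (doubled D)"
proof -
  obtain p v where unit: "p4_unit D 1 p v"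
    and turns: "turns_reversing D cell_centres" "turns_preserving D cell_corners"
    using assms(3) unfolding species_39_def by blast
  have level: "unit_of_level 1 p v" using unit unfolding p4_unit_def by blast
  note doubled = doubled_low_level[OF assms(1,2) unit _ level_1_corner_in_grid[OF level], simplified]
  have centre: "{sq_centre (2 * p) (2 * v)} = (*) 2 ` {sq_centre p v}" by (simp add: sq_centre_magnify)
  have "turns_preserving D {sq_centre p v} \<and> turns_reversing D (sq_corners p v) \<or>
      turns_reversing D {sq_centre p v} \<and> turns_preserving D (sq_corners p v)"
    using level
  proof (cases rule: level_1_corners)
    case 1
    then have "turns_preserving D (sq_corners p v)" "turns_reversing D {sq_centre p v}"
      by (auto intro: turns_mono(1)[OF turns(2)] turns_mono(2)[OF turns(1)])
    then show ?thesis by blast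
  next
    case 2
    then have "turns_reversing D (sq_corners p v)" "turns_preserving D {sq_centre p v}"
      by (auto intro: turns_mono(1)[OF turns(2)] turns_mono(2)[OF turns(1)])
    then show ?thesis by blast
  qed
  then have "turns_preserving (doubled D) {sq_centre (2 * p) (2 * v)} \<and>
        turns_reversing (doubled D) (sq_corners (2 * p) (2 * v)) \<or>
      turns_reversing (doubled D) {sq_centre (2 * p) (2 * v)} \<and>
        turns_preserving (doubled D) (sq_corners (2 * p) (2 * v))"
    unfolding centre sq_corners_magnify turns_preserving_doubled[OF assms(1)]
      turns_reversing_doubled[OF assms(1)] .
  then have "species_38 (doubled D)"
    using doubled unfolding species_38_def species_mixed_level_def numeral_3_eq_3 by blast
  then show ?thesis using doubled by simp
qed

lemma high_level_species_not_doubled: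
  assumes "fabric D" "species_33 D \<or> species_35 D \<or> species_37 D \<or> species_38 D"
  shows "\<not> isonemal (doubled D)"
proof -
  define P where "P n \<longleftrightarrow> (\<exists>p v. p4_unit D n p v \<and> centre_and_corners_in cell_corners p v)" for n
  have "P 3 \<or> P 4"
    using assms(2)
    unfolding species_33_def species_35_def species_37_def species_38_def
      species_33_level_def species_35_level_def species_mixed_level_def P_def by blast
  moreover have "3 \<le> (3 :: nat)" "3 \<le> (4 :: nat)" by simp_all
  ultimately obtain n where "n \<ge> 3" "P n" by blast
  then obtain p v where "n \<ge> 3" "p4_unit D n p v" "centre_and_corners_in cell_corners p v"
    unfolding P_def by blast
  then show ?thesis
    using doubled_not_isonemal[OF assms(1)] corner_in_sq_corners
    unfolding centre_and_corners_in_def by blast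
qed

theorem theorem8:
  fixes D :: design
  assumes "fabric D" and "isonemal D"
  shows "(species_34 D \<longrightarrow>
            fabric (doubled D) \<and> isonemal (doubled D) \<and> species_33 (doubled D)) \<and>
         (species_36 D \<longrightarrow>
            fabric (doubled D) \<and> isonemal (doubled D) \<and> species_35 (doubled D)) \<and>
         (species_39 D \<longrightarrow>
            fabric (doubled D) \<and> isonemal (doubled D) \<and> species_38 (doubled D)) \<and>
         (species_33 D \<or> species_35 D \<or> species_37 D \<or> species_38 D \<longrightarrow>
            \<not> isonemal (doubled D))"
  using assms species_34_doubled species_36_doubled species_39_doubled
    high_level_species_not_doubled by blast

end
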